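(* Let $f^N(t,v_1,\dots,v_N)$ be the joint law of the $N$ particles of the collisional particle system described in the context, and assume that $f^N$ is properly regular in the sense specified in the context. Then the normalized entropy $$H_N(f^N(t)):=\frac1N\int_{\mathbb{R}^{Nd}} f^N(t,\cdot)\,\log f^N(t,\cdot)$$ decays in time, i.e. $t\mapsto H_N(f^N(t))$ is non-increasing on $[0,\infty)$.
   Context: Let $d\ge 2$, $\Lambda>0$, $\gamma\in(-d-1,1]$, let $I_d$ be the $d\times d$ identity matrix, and for $z\in\mathbb{R}^d\setminus\{0\}$ put $$A(z)=\Lambda|z|^{\gamma}\big(|z|^2I_d-z\otimes z\big),\qquad \sigma(z)=\sqrt{A(z)}=\sqrt{\Lambda}\,|z|^{\gamma/2+1}\Big(I_d-\frac{z\otimes z}{|z|^2}\Big).$$ Collisional particle system: let $N$ be an even positive integer, $\Delta t>0$ a time step, and $t_m=m\Delta t$ for integers $m\ge0$. At time $t_0=0$, the velocities $V_1(0),\dots,V_N(0)\in\mathbb{R}^d$ are sampled independently from an initial probability density $f_0$ on $\mathbb{R}^d$. At each time $t_m$, the $N$ particles are randomly divided into $N/2$ pairs (independently of everything else); the partner of particle $i$ is denoted $\theta(i)$ (so $\theta$ depends on $m$). During $[t_m,t_{m+1})$ each pair $(i,\theta(i))$ evolves, continuously in time (also across the times $t_m$), according to $$\mathrm{d}V_i=-\mathrm{d}V_{\theta(i)}=\sigma(V_i-V_{\theta(i)})\circ \mathrm{d}W_i,$$ where $W_i=-W_{\theta(i)}$ is a $d$-dimensional Brownian motion independent of those of the other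 pairs, and $\circ$ denotes the Stratonovich integral. The joint law $f^N$ is taken for a given realization of the sequence of pairings. On each window $[t_m,t_{m+1})$, with $\theta$ the pairing used there, it satisfies the Liouville equation $$\partial_t f^N=\frac12\sum_{\text{pairs }\{i,\theta(i)\}}\nabla_{(v_i,v_{\theta(i)})}\cdot\left(\begin{bmatrix}A(v_i-v_{\theta(i)})&-A(v_i-v_{\theta(i)})\\-A(v_i-v_{\theta(i)})&A(v_i-v_{\theta(i)})\end{bmatrix}\nabla_{(v_i,v_{\theta(i)})}f^N\right),$$ where each unordered pair is counted once. "Properly regular" means: $f^N$ is strictly positive and is $C^1$ in $t$ on each window and $C^2$ in the velocities away from collisions $v_i=v_{\theta(i)}$, and satisfies the Liouville equation there; the entropy integral is finite for every $t$ and $t\mapsto H_N(f^N(t))$ is continuous on $[0,\infty)$; on each window one may differentiate under the integral sign, $\frac{\mathrm{d}}{\mathrm{d}t}\int f^N\log f^N=\int \partial_t f^N\,(\log f^N+1)$; and the integration by parts of the right-hand side of the Liouville equation against $\log f^N+1$ holds with no boundary terms and with convergent integrals. *)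

theory Defs
  imports "HOL-Probability.Probability"
begin

section \<open>The collision kernel\<close>

definition outer :: "real^'d \<Rightarrow> real^'d^'d" where
  "outer z = (\<chi> a b. z $ a * z $ b)"

text \<open>Since \<open>0 powr \<gamma> = 0\<close> for every \<open>\<gamma>\<close>, both matrices below take the value \<open>0\<close> at \<open>z = 0\<close>,
  where for singular \<open>\<gamma>\<close> the formulas have no meaning.\<close>

definition kernel_A :: "real \<Rightarrow> real \<Rightarrow> real^'d \<Rightarrow> real^'d^'d" where
  "kernel_A \<Lambda> \<gamma> z = (\<Lambda> * norm z powr \<gamma>) *\<^sub>R ((norm z)\<^sup>2 *\<^sub>R mat 1 - outer z)"

definition kernel_sigma :: "real \<Rightarrow> real \<Rightarrow> real^'d \<Rightarrow> real^'d^'d" where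
  "kernel_sigma \<Lambda> \<gamma> z =
     (sqrt \<Lambda> * norm z powr (\<gamma> / 2 + 1)) *\<^sub>R (mat 1 - (1 / (norm z)\<^sup>2) *\<^sub>R outer z)"

text \<open>\<open>kernel_sigma\<close> is the positive semidefinite square root of \<open>kernel_A\<close>.\<close>

lemma outer_mult_vec: "outer z *v x = (z \<bullet> x) *\<^sub>R z"
  by (simp add: outer_def vec_eq_iff matrix_vector_mult_def inner_vec_def sum_distrib_left mult_ac)

lemma kernel_sigma_mult_vec:
  "kernel_sigma \<Lambda> \<gamma> z *v x =
     (sqrt \<Lambda> * norm z powr (\<gamma> / 2 + 1)) *\<^sub>R (x - ((z \<bullet> x) / (norm z)\<^sup>2) *\<^sub>R z)"
  by (simp add: kernel_sigma_def scaleR_matrix_vector_assoc [symmetric]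
      matrix_vector_mult_diff_rdistrib outer_mult_vec)

lemma kernel_A_mult_vec:
  "kernel_A \<Lambda> \<gamma> z *v x = (\<Lambda> * norm z powr \<gamma>) *\<^sub>R ((norm z)\<^sup>2 *\<^sub>R x - (z \<bullet> x) *\<^sub>R z)"
  by (simp add: kernel_A_def scaleR_matrix_vector_assoc [symmetric]
      matrix_vector_mult_diff_rdistrib outer_mult_vec)

lemma kernel_sigma_square:
  assumes "\<Lambda> > 0"
  shows "kernel_sigma \<Lambda> \<gamma> z ** kernel_sigma \<Lambda> \<gamma> z = kernel_A \<Lambda> \<gamma> z"
proof (cases "z = 0")
  case True
  then show ?thesis
    by (simp add: kernel_sigma_def kernel_A_def)
next
  case False
  define r where "r = norm z"
  have r: "r > 0" and zz: "z \<bullet> z = r\<^sup>2"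
    using False by (simp_all add: r_def power2_norm_eq_inner)
  have pw: "(r powr (\<gamma> / 2 + 1))\<^sup>2 = r powr \<gamma> * r\<^sup>2"
  proof -
    have "(r powr (\<gamma> / 2 + 1))\<^sup>2 = r powr (\<gamma> + 2)"
      by (simp add: power2_eq_square flip: powr_add)
    also have "\<dots> = r powr \<gamma> * r powr (real 2)"
      by (simp add: powr_add)
    finally show ?thesis using r by (simp add: powr_realpow del: of_nat_numeral)
  qed
  define c where "c = sqrt \<Lambda> * r powr (\<gamma> / 2 + 1)"
  have c: "c * c = \<Lambda> * r powr \<gamma> * r\<^sup>2"
    using assms pw by (simp add: c_def power2_eq_square algebra_simps)
  have "(kernel_sigma \<Lambda> \<gamma> z ** kernel_sigma \<Lambda> \<gamma> z) *v x = kernel_A \<Lambda> \<gamma> z *v x" for x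
  proof -
    define u where "u = x - ((z \<bullet> x) / r\<^sup>2) *\<^sub>R z"
    have zu: "z \<bullet> u = 0"
      using r by (simp add: u_def inner_diff_right zz)
    have "(kernel_sigma \<Lambda> \<gamma> z ** kernel_sigma \<Lambda> \<gamma> z) *v x = (c * c) *\<^sub>R u"
      using zu by (simp add: kernel_sigma_mult_vec r_def [symmetric] c_def [symmetric]
          u_def [symmetric] flip: matrix_vector_mul_assoc)
    also have "\<dots> = (\<Lambda> * r powr \<gamma>) *\<^sub>R (r\<^sup>2 *\<^sub>R u)"
      by (simp add: c)
    also have "r\<^sup>2 *\<^sub>R u = r\<^sup>2 *\<^sub>R x - (z \<bullet> x) *\<^sub>R z"
      using r by (simp add: u_def scaleR_right_diff_distrib)
    finally show ?thesis by (simp add: kernel_A_mult_vec r_def)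
  qed
  then show ?thesis by (simp add: matrix_eq)
qed

lemma kernel_sigma_symmetric: "transpose (kernel_sigma \<Lambda> \<gamma> z) = kernel_sigma \<Lambda> \<gamma> z"
  by (simp add: transpose_def kernel_sigma_def outer_def mat_def vec_eq_iff mult_ac)

lemma kernel_sigma_psd:
  assumes "\<Lambda> > 0"
  shows "x \<bullet> (kernel_sigma \<Lambda> \<gamma> z *v x) \<ge> 0"
proof -
  have "(z \<bullet> x) * (z \<bullet> x) / (norm z)\<^sup>2 \<le> x \<bullet> x"
  proof (cases "z = 0")
    case False
    have "(z \<bullet> x)\<^sup>2 \<le> (z \<bullet> z) * (x \<bullet> x)"
      by (rule Cauchy_Schwarz_ineq)
    then show ?thesis
      using False by (simp add: power2_norm_eq_inner power2_eq_square [of "z \<bullet> x"] field_simps)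
  qed simp
  then show ?thesis
    using assms by (simp add: kernel_sigma_mult_vec inner_diff_right inner_commute)
qed


section \<open>Brownian motions and the Stratonovich integral\<close>

text \<open>Density of the centred Gaussian law on \<open>real^'d\<close> with covariance \<open>s\<close> times the identity.\<close>

definition gauss_density :: "real \<Rightarrow> real^'d \<Rightarrow> real" where
  "gauss_density s x = (\<Prod>k\<in>UNIV. normal_density 0 (sqrt s) (x $ k))"

text \<open>\<open>(W i)\<close>, \<open>i \<in> R\<close>, are independent standard Brownian motions on the time interval \<open>[a, b]\<close>,
  started from \<open>0\<close> at time \<open>a\<close>, relative to the filtration \<open>F\<close>: the increments over
  \<open>[s, t]\<close> of the different \<open>W i\<close> are jointly independent, and independent of \<open>F s\<close>
  (index \<open>None\<close> stands for the sigma-algebra \<open>F s\<close>).\<close>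

definition independent_brownian_motions ::
  "'w measure \<Rightarrow> (real \<Rightarrow> 'w measure) \<Rightarrow> real \<Rightarrow> real \<Rightarrow> 'n set \<Rightarrow>
     ('n \<Rightarrow> real \<Rightarrow> 'w \<Rightarrow> real^'d) \<Rightarrow> bool" where
  "independent_brownian_motions M F a b R W \<longleftrightarrow>
     (\<forall>i\<in>R. \<forall>t\<in>{a..b}. W i t \<in> borel_measurable (F t)) \<and>
     (\<forall>i\<in>R. AE \<omega> in M. W i a \<omega> = 0) \<and>
     (\<forall>i\<in>R. AE \<omega> in M. continuous_on {a..b} (\<lambda>t. W i t \<omega>)) \<and>
     (\<forall>s t. a \<le> s \<and> s < t \<and> t \<le> b \<longrightarrow>
        (\<forall>i\<in>R. distributed M lborel (\<lambda>\<omega>. W i t \<omega> - W i s \<omega>)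
                  (\<lambda>x. ennreal (gauss_density (t - s) x))) \<and>
        prob_space.indep_sets M
          (\<lambda>k. case k of
               None \<Rightarrow> sets (F s)
             | Some i \<Rightarrow> {(\<lambda>\<omega>. W i t \<omega> - W i s \<omega>) -` B \<inter> space M | B. B \<in> sets borel})
          (insert None (Some ` R)))"

definition partition_of :: "real \<Rightarrow> real \<Rightarrow> nat \<Rightarrow> (nat \<Rightarrow> real) \<Rightarrow> bool" where
  "partition_of a b n p \<longleftrightarrow> p 0 = a \<and> p n = b \<and> (\<forall>k<n. p k \<le> p (Suc k))"

definition stratonovich_sum ::
  "(real \<Rightarrow> 'w \<Rightarrow> real^'d^'d) \<Rightarrow> (real \<Rightarrow> 'w \<Rightarrow> real^'d) \<Rightarrow> nat \<Rightarrow> (nat \<Rightarrow> real) \<Rightarrow> 'w \<Rightarrow> real^'d" where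
  "stratonovich_sum H W n p \<omega> =
     (\<Sum>k<n. ((1 / 2) *\<^sub>R (H (p k) \<omega> + H (p (Suc k)) \<omega>)) *v (W (p (Suc k)) \<omega> - W (p k) \<omega>))"

text \<open>\<open>X\<close> is the Stratonovich integral of \<open>H\<close> against \<open>W\<close> over \<open>[a, b]\<close>: the limit in
  probability, as the mesh of the partition tends to \<open>0\<close>, of the sums in which the integrand is
  averaged over the two endpoints of each subinterval. For continuous semimartingales this limit
  exists and is the Ito integral plus half the covariation.\<close>

definition has_stratonovich_integral ::
  "'w measure \<Rightarrow> (real \<Rightarrow> 'w \<Rightarrow> real^'d^'d) \<Rightarrow> (real \<Rightarrow> 'w \<Rightarrow> real^'d) \<Rightarrow>
     real \<Rightarrow> real \<Rightarrow> ('w \<Rightarrow> real^'d) \<Rightarrow> bool" where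
  "has_stratonovich_integral M H W a b X \<longleftrightarrow>
     X \<in> borel_measurable M \<and>
     (\<forall>\<epsilon>>0. \<exists>\<delta>>0. \<forall>n p. partition_of a b n p \<and> (\<forall>k<n. p (Suc k) - p k < \<delta>) \<longrightarrow>
        measure M {\<omega> \<in> space M. norm (stratonovich_sum H W n p \<omega> - X \<omega>) > \<epsilon>} < \<epsilon>)"


section \<open>The collisional particle system\<close>

text \<open>Particles are labelled by the finite linearly ordered type \<open>'n\<close>, and \<open>\<theta> m\<close> is the
  pairing (a fixed-point free involution) used on the \<open>m\<close>-th window; the sequence \<open>\<theta>\<close> is a given
  realization of the random pairings. As these are independent of the initial data and the Brownian
  motions, \<open>M\<close> plays the role of the conditional probability given the pairings. The particles
  \<open>i < \<theta> m i\<close> form a system of representatives of the unordered pairs, and \<open>W m i\<close> is the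
  Brownian motion driving particle \<open>i\<close> on the \<open>m\<close>-th window.\<close>

definition pairing :: "('n \<Rightarrow> 'n) \<Rightarrow> bool" where
  "pairing \<tau> \<longleftrightarrow> (\<forall>i. \<tau> i \<noteq> i \<and> \<tau> (\<tau> i) = i)"

definition window :: "real \<Rightarrow> nat \<Rightarrow> real set" where
  "window \<Delta>t m = {real m * \<Delta>t ..< real (Suc m) * \<Delta>t}"

locale collisional_particle_system =
  prob_space M + filtration "space M" F
  for M :: "'w measure" and F :: "real \<Rightarrow> 'w measure" +
  fixes \<Lambda> \<gamma> \<Delta>t :: real
    and \<theta> :: "nat \<Rightarrow> 'n::{finite,linorder} \<Rightarrow> 'n"
    and f0 :: "real^'d \<Rightarrow> real"
    and W :: "nat \<Rightarrow> 'n \<Rightarrow> real \<Rightarrow> 'w \<Rightarrow> real^'d"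
    and V :: "'n \<Rightarrow> real \<Rightarrow> 'w \<Rightarrow> real^'d"
  assumes subalgebra: "subalgebra M (F t)"
    and pairing: "pairing (\<theta> m)"
    and f0_nonneg: "f0 v \<ge> 0"
    and initial_density: "distributed M lborel (V i 0) (\<lambda>v. ennreal (f0 v))"
    and initial_indep: "indep_vars (\<lambda>_. borel) (\<lambda>i. V i 0) UNIV"
    and adapted: "t \<ge> 0 \<Longrightarrow> V i t \<in> borel_measurable (F t)"
    and continuous: "AE \<omega> in M. continuous_on {0..} (\<lambda>t. V i t \<omega>)"
    and brownian: "independent_brownian_motions M F (real m * \<Delta>t) (real (Suc m) * \<Delta>t)
           {i. i < \<theta> m i} (W m)"
    and opposite: "\<omega> \<in> space M \<Longrightarrow> real m * \<Delta>t \<le> t \<Longrightarrow> t \<le> real (Suc m) * \<Delta>t \<Longrightarrow>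
           W m (\<theta> m i) t \<omega> = - W m i t \<omega>"
    and sde: "real m * \<Delta>t \<le> t \<Longrightarrow> t \<le> real (Suc m) * \<Delta>t \<Longrightarrow>
           has_stratonovich_integral M
             (\<lambda>s \<omega>. kernel_sigma \<Lambda> \<gamma> (V i s \<omega> - V (\<theta> m i) s \<omega>)) (W m i) (real m * \<Delta>t) t
             (\<lambda>\<omega>. V i t \<omega> - V i (real m * \<Delta>t) \<omega>)"
    and momentum: "real m * \<Delta>t \<le> t \<Longrightarrow> t \<le> real (Suc m) * \<Delta>t \<Longrightarrow>
           AE \<omega> in M. V i t \<omega> - V i (real m * \<Delta>t) \<omega> =
             - (V (\<theta> m i) t \<omega> - V (\<theta> m i) (real m * \<Delta>t) \<omega>)"

definition joint_law_density ::
  "'w measure \<Rightarrow> ('n::finite \<Rightarrow> real \<Rightarrow> 'w \<Rightarrow> real^'d) \<Rightarrow> (real \<Rightarrow> (real^'d)^'n \<Rightarrow> real) \<Rightarrow> bool" where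
  "joint_law_density M V f \<longleftrightarrow>
     (\<forall>t\<ge>0. distributed M lborel (\<lambda>\<omega>. \<chi> i. V i t \<omega>) (\<lambda>v. ennreal (f t v)))"


section \<open>The Liouville equation\<close>

definition partial :: "'n \<Rightarrow> 'd \<Rightarrow> ((real^'d)^'n \<Rightarrow> real) \<Rightarrow> (real^'d)^'n \<Rightarrow> real" where
  "partial i k g v = deriv (\<lambda>h. g (v + h *\<^sub>R axis i (axis k 1))) 0"

definition grad :: "'n \<Rightarrow> ((real^'d)^'n \<Rightarrow> real) \<Rightarrow> (real^'d)^'n \<Rightarrow> real^'d" where
  "grad i g v = (\<chi> k. partial i k g v)"

text \<open>Vectors and vector fields in the variables \<open>(v\<^sub>i, v\<^sub>j)\<close> are written as pairs.\<close>

definition pair_grad ::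
  "'n \<Rightarrow> 'n \<Rightarrow> ((real^'d)^'n \<Rightarrow> real) \<Rightarrow> (real^'d)^'n \<Rightarrow> (real^'d) \<times> (real^'d)" where
  "pair_grad i j g v = (grad i g v, grad j g v)"

definition pair_div ::
  "'n \<Rightarrow> 'n \<Rightarrow> ((real^'d)^'n \<Rightarrow> (real^'d) \<times> (real^'d)) \<Rightarrow> (real^'d)^'n \<Rightarrow> real" where
  "pair_div i j G v =
     (\<Sum>k\<in>UNIV. partial i k (\<lambda>w. fst (G w) $ k) v) + (\<Sum>k\<in>UNIV. partial j k (\<lambda>w. snd (G w) $ k) v)"

text \<open>Multiplication by the block matrix with rows \<open>(B, -B)\<close> and \<open>(-B, B)\<close>.\<close>

definition block_mult :: "real^'d^'d \<Rightarrow> (real^'d) \<times> (real^'d) \<Rightarrow> (real^'d) \<times> (real^'d)" where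
  "block_mult B pq = (B *v fst pq + (- B) *v snd pq, (- B) *v fst pq + B *v snd pq)"

definition pair_flux ::
  "real \<Rightarrow> real \<Rightarrow> 'n \<Rightarrow> 'n \<Rightarrow> ((real^'d)^'n \<Rightarrow> real) \<Rightarrow> (real^'d)^'n \<Rightarrow> (real^'d) \<times> (real^'d)" where
  "pair_flux \<Lambda> \<gamma> i j g v = block_mult (kernel_A \<Lambda> \<gamma> (v $ i - v $ j)) (pair_grad i j g v)"

definition liouville_rhs ::
  "real \<Rightarrow> real \<Rightarrow> ('n::{finite,linorder} \<Rightarrow> 'n) \<Rightarrow> ((real^'d)^'n::{finite,linorder} \<Rightarrow> real) \<Rightarrow> (real^'d)^'n::{finite,linorder} \<Rightarrow> real" where
  "liouville_rhs \<Lambda> \<gamma> \<tau> g v =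
     (1 / 2) * (\<Sum>i | i < \<tau> i. pair_div i (\<tau> i) (pair_flux \<Lambda> \<gamma> i (\<tau> i) g) v)"

definition no_collision :: "('n \<Rightarrow> 'n) \<Rightarrow> ((real^'d)^'n) set" where
  "no_collision \<tau> = {v. \<forall>i. v $ i \<noteq> v $ \<tau> i}"

text \<open>Time derivative within a window, one-sided at its left endpoint.\<close>

definition time_deriv :: "real set \<Rightarrow> (real \<Rightarrow> 'v \<Rightarrow> real) \<Rightarrow> real \<Rightarrow> 'v \<Rightarrow> real" where
  "time_deriv I f t v = vector_derivative (\<lambda>s. f s v) (at t within I)"

definition C1_in_time_on :: "real set \<Rightarrow> (real \<Rightarrow> real) \<Rightarrow> bool" where
  "C1_in_time_on I g \<longleftrightarrow>
     (\<forall>t\<in>I. g differentiable (at t within I)) \<and>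
     continuous_on I (\<lambda>t. vector_derivative g (at t within I))"

definition C2_on :: "('v::real_normed_vector) set \<Rightarrow> ('v \<Rightarrow> real) \<Rightarrow> bool" where
  "C2_on S g \<longleftrightarrow>
     (\<exists>(g' :: 'v \<Rightarrow> 'v \<Rightarrow>\<^sub>L real) (g'' :: 'v \<Rightarrow> 'v \<Rightarrow>\<^sub>L ('v \<Rightarrow>\<^sub>L real)).
        (\<forall>v\<in>S. (g has_derivative blinfun_apply (g' v)) (at v) \<and>
                (g' has_derivative blinfun_apply (g'' v)) (at v)) \<and>
        continuous_on S g'')"


section \<open>Entropy and regularity\<close>

definition normalized_entropy :: "((real^'d)^'n::finite \<Rightarrow> real) \<Rightarrow> real" where
  "normalized_entropy g = (1 / real CARD('n)) * (\<integral>v. g v * ln (g v) \<partial>lborel)"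

text \<open>The integrands containing derivatives of \<open>f\<close> are meaningful only off the null set of
  collisions; taking these integrals over \<open>lebesgue\<close> rather than \<open>lborel\<close> makes their
  values on that set irrelevant also for measurability.\<close>

definition properly_regular ::
  "real \<Rightarrow> real \<Rightarrow> real \<Rightarrow> (nat \<Rightarrow> 'n::{finite,linorder} \<Rightarrow> 'n) \<Rightarrow>
     (real \<Rightarrow> (real^'d)^'n::{finite,linorder} \<Rightarrow> real) \<Rightarrow> bool" where
  "properly_regular \<Lambda> \<gamma> \<Delta>t \<theta> f \<longleftrightarrow>
     (\<forall>t\<ge>0. \<forall>v. f t v > 0) \<and>
     (\<forall>m. \<forall>v\<in>no_collision (\<theta> m). C1_in_time_on (window \<Delta>t m) (\<lambda>t. f t v)) \<and>
     (\<forall>m. \<forall>t\<in>window \<Delta>t m. C2_on (no_collision (\<theta> m)) (f t)) \<and>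
     (\<forall>m. \<forall>t\<in>window \<Delta>t m. \<forall>v\<in>no_collision (\<theta> m).
        time_deriv (window \<Delta>t m) f t v = liouville_rhs \<Lambda> \<gamma> (\<theta> m) (f t) v) \<and>
     (\<forall>t\<ge>0. integrable lborel (\<lambda>v. f t v * ln (f t v))) \<and>
     continuous_on {0..} (\<lambda>t. normalized_entropy (f t)) \<and>
     (\<forall>m. \<forall>t\<in>window \<Delta>t m.
        integrable lebesgue (\<lambda>v. time_deriv (window \<Delta>t m) f t v * (ln (f t v) + 1)) \<and>
        ((\<lambda>s. \<integral>v. f s v * ln (f s v) \<partial>lborel) has_real_derivative
           (\<integral>v. time_deriv (window \<Delta>t m) f t v * (ln (f t v) + 1) \<partial>lebesgue))
          (at t within window \<Delta>t m)) \<and>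
     (\<forall>m. \<forall>t\<in>window \<Delta>t m.
        integrable lebesgue (\<lambda>v. liouville_rhs \<Lambda> \<gamma> (\<theta> m) (f t) v * (ln (f t v) + 1)) \<and>
        (\<forall>i. i < \<theta> m i \<longrightarrow>
           integrable lebesgue (\<lambda>v. pair_flux \<Lambda> \<gamma> i (\<theta> m i) (f t) v \<bullet>
                                    pair_grad i (\<theta> m i) (\<lambda>w. ln (f t w) + 1) v)) \<and>
        (\<integral>v. liouville_rhs \<Lambda> \<gamma> (\<theta> m) (f t) v * (ln (f t v) + 1) \<partial>lebesgue) =
          - (1 / 2) * (\<Sum>i | i < \<theta> m i.
              \<integral>v. pair_flux \<Lambda> \<gamma> i (\<theta> m i) (f t) v \<bullet>
                  pair_grad i (\<theta> m i) (\<lambda>w. ln (f t w) + 1) v \<partial>lebesgue))"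

end

theory Submission
  imports Defs
begin

text \<open>
  For a properly regular density, within a window, differentiating the entropy under the
  integral sign, inserting the Liouville equation and integrating by parts shows that \<open>\<integral> f log f\<close>
  has the time derivative
  \<open>- 1/2\<close> times the sum over the pairs \<open>{i, j}\<close> of
  \<open>\<integral> 1/f (\<nabla>\<^sub>i f - \<nabla>\<^sub>j f) \<bullet> A(v\<^sub>i - v\<^sub>j) (\<nabla>\<^sub>i f - \<nabla>\<^sub>j f)\<close>,
  because \<open>\<nabla> log f = \<nabla> f / f\<close> and the block matrix with rows \<open>(A, -A)\<close> and \<open>(-A, A)\<close> only sees
  the difference of the two gradients. The matrix \<open>A\<close> is positive semidefinite by the
  Cauchy-Schwarz inequality, so the entropy production has a sign
  (\<open>pair_flux_inner_grad_log_nonneg\<close>). The equation and the chain rule are available only away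
  from collisions, which is enough since the collisions of finitely many pairs form a finite union
  of proper subspaces, a null set (\<open>AE_no_collision\<close>).

  The pairing, and with it the vector field, jumps at the times \<open>t\<^sub>m\<close>, so the entropy need not be
  differentiable there; its continuity extends the monotonicity to the closed windows and lets
  these be glued together (\<open>antimono_on_of_windows\<close>).
\<close>

section \<open>Collisions are negligible\<close>

text \<open>Particles that coincide agree in particular in one coordinate, and this already confines the
  configuration to a hyperplane.\<close>

lemma negligible_coincidence:
  fixes i j :: "'n::finite"
  assumes "i \<noteq> j"
  shows "negligible {v :: (real^'d)^'n. v $ i = v $ j}"
proof -
  fix k :: 'd
  define e :: "(real^'d)^'n" where "e = axis i (axis k 1) - axis j (axis k 1)"
  have "e $ i $ k = 1"
    using assms by (simp add: e_def axis_def)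
  then have "e \<noteq> 0"
    by auto
  then have "negligible {v. e \<bullet> v = 0}"
    by (intro negligible_hyperplane) simp
  moreover have "{v. v $ i = v $ j} \<subseteq> {v. e \<bullet> v = 0}"
    by (auto simp: e_def inner_diff_left inner_axis')
  ultimately show ?thesis
    by (rule negligible_subset)
qed

lemma AE_no_collision:
  fixes \<tau> :: "'n::finite \<Rightarrow> 'n"
  assumes "pairing \<tau>"
  shows "AE v :: (real^'d)^'n in lebesgue. v \<in> no_collision \<tau>"
proof -
  have "negligible (\<Union>i. {v :: (real^'d)^'n. v $ i = v $ \<tau> i})"
    using assms by (intro negligible_Union)
      (auto simp: pairing_def neq_commute intro!: negligible_coincidence)
  also have "(\<Union>i. {v :: (real^'d)^'n. v $ i = v $ \<tau> i}) = {v. v \<notin> no_collision \<tau>}"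
    by (auto simp: no_collision_def)
  finally show ?thesis
    by (intro AE_I'[of "{v. v \<notin> no_collision \<tau>}"]) (auto simp: negligible_iff_null_sets)
qed

section \<open>The sign of the entropy production\<close>

lemma kernel_A_psd:
  assumes "\<Lambda> \<ge> 0"
  shows "x \<bullet> (kernel_A \<Lambda> \<gamma> z *v x) \<ge> 0"
proof -
  have "(z \<bullet> x)\<^sup>2 \<le> (z \<bullet> z) * (x \<bullet> x)"
    by (rule Cauchy_Schwarz_ineq)
  then have "0 \<le> x \<bullet> ((norm z)\<^sup>2 *\<^sub>R x - (z \<bullet> x) *\<^sub>R z)"
    by (simp add: inner_diff_right power2_norm_eq_inner power2_eq_square[of "x \<bullet> z"]
        inner_commute)
  then show ?thesis
    using assms by (simp add: kernel_A_mult_vec)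
qed

lemma partial_ln:
  assumes "g differentiable at v" and "g v > 0"
  shows "partial i k (\<lambda>w. ln (g w) + c) v = partial i k g v / g v"
proof -
  obtain D where D: "(g has_derivative D) (at v)"
    using assms(1) by (auto simp: differentiable_def)
  define u where "u = axis i (axis k (1::real))"
  interpret D: bounded_linear D
    using D by (rule has_derivative_bounded_linear)
  have "((\<lambda>h::real. v + h *\<^sub>R u) has_derivative (\<lambda>h. h *\<^sub>R u)) (at 0)"
    by (auto intro!: derivative_eq_intros)
  then have "((\<lambda>h. g (v + h *\<^sub>R u)) has_derivative (\<lambda>h. D (h *\<^sub>R u))) (at 0)"
    by (rule has_derivative_compose) (simp add: D)
  then have line: "((\<lambda>h. g (v + h *\<^sub>R u)) has_real_derivative D u) (at 0)"
    by (simp add: has_field_derivative_def D.scaleR mult_commute_abs)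
  then have "((\<lambda>h. ln (g (v + h *\<^sub>R u)) + c) has_real_derivative D u / g v) (at 0)"
    using assms(2) by (auto intro!: derivative_eq_intros)
  with line show ?thesis
    by (simp add: partial_def u_def DERIV_imp_deriv)
qed

lemma grad_ln:
  assumes "g differentiable at v" and "g v > 0"
  shows "grad i (\<lambda>w. ln (g w) + c) v = (1 / g v) *\<^sub>R grad i g v"
  using assms by (simp add: grad_def vec_eq_iff partial_ln)

lemma block_mult_inner:
  "block_mult B (p, q) \<bullet> (p, q) = (p - q) \<bullet> (B *v (p - q))"
  by (simp add: block_mult_def inner_Pair matrix_vector_mult_diff_distrib inner_diff_left
      inner_diff_right inner_add_left inner_commute
      scaleR_matrix_vector_assoc[of "-1", symmetric, simplified])

text \<open>Testing the flux of \<open>g\<close> against \<open>\<nabla> log g\<close> instead of \<open>\<nabla> g\<close> only costs the positive factor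
  \<open>1 / g\<close>, so the integrand of the entropy production is a weighted quadratic form in \<open>\<nabla> g\<close>.\<close>

lemma pair_flux_inner_grad_log_nonneg:
  assumes "\<Lambda> \<ge> 0" and "g differentiable at v" and "g v > 0"
  shows "pair_flux \<Lambda> \<gamma> i j g v \<bullet> pair_grad i j (\<lambda>w. ln (g w) + c) v \<ge> 0"
proof -
  have "pair_grad i j (\<lambda>w. ln (g w) + c) v = (1 / g v) *\<^sub>R (grad i g v, grad j g v)"
    using assms by (simp add: pair_grad_def grad_ln)
  then have "pair_flux \<Lambda> \<gamma> i j g v \<bullet> pair_grad i j (\<lambda>w. ln (g w) + c) v =
      (1 / g v) * ((grad i g v - grad j g v) \<bullet>
        (kernel_A \<Lambda> \<gamma> (v $ i - v $ j) *v (grad i g v - grad j g v)))"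
    by (simp only: pair_flux_def pair_grad_def inner_scaleR_right block_mult_inner)
  then show ?thesis
    using assms(3) by (simp add: kernel_A_psd[OF assms(1)])
qed

lemma C2_on_imp_differentiable:
  assumes "C2_on S g" and "v \<in> S"
  shows "g differentiable at v"
  using assms by (auto simp: C2_on_def differentiable_def)

section \<open>Monotonicity of the entropy\<close>

text \<open>Collisions between other pairs may spoil differentiability where the flux of the pair
  \<open>{i, j}\<close> is unproblematic, and at collisions of the pair itself the Liouville equation
  is not available; hence all pointwise facts are used almost everywhere, off the collisions of
  every pair.\<close>

lemma entropy_production_nonpos:
  assumes "properly_regular \<Lambda> \<gamma> \<Delta>t \<theta> f" and "\<Lambda> \<ge> 0" and "\<Delta>t \<ge> 0"
    and pairing: "pairing (\<theta> m)" and t: "t \<in> window \<Delta>t m"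
  shows "(\<integral>v. time_deriv (window \<Delta>t m) f t v * (ln (f t v) + 1) \<partial>lebesgue) \<le> 0"
proof -
  note reg = assms(1)[unfolded properly_regular_def]
  have "0 \<le> real m * \<Delta>t"
    using assms(3) by simp
  then have "t \<ge> 0"
    using t unfolding window_def atLeastLessThan_iff by linarith
  then have pos: "f t v > 0" for v
    using reg by blast
  have diff: "f t differentiable at v" if "v \<in> no_collision (\<theta> m)" for v
    using reg t that by (blast intro: C2_on_imp_differentiable)
  have AE: "AE v in lebesgue. v \<in> no_collision (\<theta> m)"
    using pairing by (rule AE_no_collision)
  have "(\<integral>v. time_deriv (window \<Delta>t m) f t v * (ln (f t v) + 1) \<partial>lebesgue) =
        (\<integral>v. liouville_rhs \<Lambda> \<gamma> (\<theta> m) (f t) v * (ln (f t v) + 1) \<partial>lebesgue)"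
  proof (rule integral_cong_AE)
    show "(\<lambda>v. time_deriv (window \<Delta>t m) f t v * (ln (f t v) + 1)) \<in> borel_measurable lebesgue"
      using reg t by (blast intro: borel_measurable_integrable)
    show "(\<lambda>v. liouville_rhs \<Lambda> \<gamma> (\<theta> m) (f t) v * (ln (f t v) + 1)) \<in> borel_measurable lebesgue"
      using reg t by (blast intro: borel_measurable_integrable)
    have "time_deriv (window \<Delta>t m) f t v = liouville_rhs \<Lambda> \<gamma> (\<theta> m) (f t) v"
      if "v \<in> no_collision (\<theta> m)" for v
      using reg t that by blast
    then show "AE v in lebesgue. time_deriv (window \<Delta>t m) f t v * (ln (f t v) + 1) =
        liouville_rhs \<Lambda> \<gamma> (\<theta> m) (f t) v * (ln (f t v) + 1)"
      using AE by (auto elim: eventually_mono)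
  qed
  also have "\<dots> = - (1 / 2) * (\<Sum>i | i < \<theta> m i.
      \<integral>v. pair_flux \<Lambda> \<gamma> i (\<theta> m i) (f t) v \<bullet>
          pair_grad i (\<theta> m i) (\<lambda>w. ln (f t w) + 1) v \<partial>lebesgue)"
    using reg t by blast
  also have "\<dots> \<le> 0"
  proof -
    have "(\<integral>v. pair_flux \<Lambda> \<gamma> i j (f t) v \<bullet> pair_grad i j (\<lambda>w. ln (f t w) + 1) v \<partial>lebesgue) \<ge> 0"
      for i j
    proof (rule integral_nonneg_AE)
      show "AE v in lebesgue.
          0 \<le> pair_flux \<Lambda> \<gamma> i j (f t) v \<bullet> pair_grad i j (\<lambda>w. ln (f t w) + 1) v"
        using AE
        by eventually_elim (intro pair_flux_inner_grad_log_nonneg assms(2) diff pos)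
    qed
    then show ?thesis
      by (simp add: sum_nonneg)
  qed
  finally show ?thesis .
qed

text \<open>The derivative is controlled only on the half-open window. Continuity of the entropy adds the
  right endpoint, which is what makes consecutive windows overlap.\<close>

lemma normalized_entropy_decreases_on_closed_window:
  fixes f :: "real \<Rightarrow> (real^'d)^'n::{finite,linorder} \<Rightarrow> real"
  assumes reg: "properly_regular \<Lambda> \<gamma> \<Delta>t \<theta> f" and "\<Lambda> \<ge> 0" and "\<Delta>t \<ge> 0"
    and "pairing (\<theta> m)"
    and st: "real m * \<Delta>t \<le> s" "s \<le> t" "t \<le> real (Suc m) * \<Delta>t"
  shows "normalized_entropy (f t) \<le> normalized_entropy (f s)"
proof (rule DERIV_nonpos_imp_decreasing_open[OF st(2)])
  have "0 \<le> real m * \<Delta>t"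
    using assms(3) by simp
  then have "s \<ge> 0"
    using st(1) by linarith
  moreover have "continuous_on {0..} (\<lambda>t. normalized_entropy (f t))"
    using reg unfolding properly_regular_def by blast
  ultimately show "continuous_on {s..t} (\<lambda>t. normalized_entropy (f t))"
    by (auto elim: continuous_on_subset)
next
  fix x assume "s < x" "x < t"
  then have inner: "x \<in> {real m * \<Delta>t <..< real (Suc m) * \<Delta>t}"
    using st by auto
  then have x: "x \<in> window \<Delta>t m"
    by (auto simp: window_def)
  \<comment> \<open>Away from the endpoints the derivative relative to the window is two-sided, as the mean
    value theorem requires.\<close>
  have "x \<in> interior (window \<Delta>t m)"
    using inner by (simp add: window_def)
  then have at: "at x within window \<Delta>t m = at x"
    by (rule at_within_interior)
  define P where "P = (\<integral>v. time_deriv (window \<Delta>t m) f x v * (ln (f x v) + 1) \<partial>lebesgue)"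
  have "((\<lambda>s. \<integral>v. f s v * ln (f s v) \<partial>lborel) has_real_derivative P) (at x)"
    using reg x unfolding properly_regular_def P_def at[symmetric] by blast
  then have "((\<lambda>t. normalized_entropy (f t)) has_real_derivative 1 / real CARD('n) * P) (at x)"
    unfolding normalized_entropy_def by (rule DERIV_cmult)
  moreover have "1 / real CARD('n) * P \<le> 0"
    using entropy_production_nonpos[OF assms(1-4) x] by (simp add: P_def divide_nonpos_nonneg)
  ultimately show "\<exists>y. ((\<lambda>t. normalized_entropy (f t)) has_real_derivative y) (at x) \<and> y \<le> 0"
    by blast
qed

text \<open>Two times in different windows are compared through the grid points between them, on which
  \<open>g\<close> is a decreasing sequence.\<close>

lemma antimono_on_of_windows:
  fixes g :: "real \<Rightarrow> real"
  assumes "h > 0"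
    and step: "\<And>m s t. real m * h \<le> s \<Longrightarrow> s \<le> t \<Longrightarrow> t \<le> real (Suc m) * h \<Longrightarrow> g t \<le> g s"
  shows "antimono_on {0..} g"
proof (rule monotone_onI)
  fix s t :: real assume st: "s \<in> {0..}" "t \<in> {0..}" "s \<le> t"
  define m where "m r = nat \<lfloor>r / h\<rfloor>" for r
  have m: "real (m r) * h \<le> r" "r \<le> real (Suc (m r)) * h" if "r \<ge> 0" for r
  proof -
    have "real (m r) \<le> r / h" "r / h \<le> real (Suc (m r))"
      using that assms(1) by (simp_all add: m_def) linarith
    then show "real (m r) * h \<le> r" "r \<le> real (Suc (m r)) * h"
      using assms(1) by (simp_all only: pos_le_divide_eq pos_divide_le_eq)
  qed
  have "decseq (\<lambda>n. g (real n * h))"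
  proof (rule decseq_SucI)
    show "g (real (Suc n) * h) \<le> g (real n * h)" for n
      using assms(1) by (intro step[of n]) auto
  qed
  then have grid: "g (real n * h) \<le> g (real k * h)" if "k \<le> n" for k n
    using that by (simp add: decseq_def)
  have "m s \<le> m t"
    using st(3) assms(1) by (simp add: m_def nat_mono floor_mono divide_right_mono)
  then consider "m s = m t" | "Suc (m s) \<le> m t"
    by linarith
  then show "g t \<le> g s"
  proof cases
    case 1
    then show ?thesis
      using m[of s] m[of t] st by (intro step[of "m s"]) auto
  next
    case 2
    have "g t \<le> g (real (m t) * h)"
      using m[of t] st by (intro step[of "m t"]) auto
    also have "\<dots> \<le> g (real (Suc (m s)) * h)"
      by (rule grid[OF 2])
    also have "\<dots> \<le> g s"
      using m[of s] st by (intro step[of "m s"]) auto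
    finally show ?thesis .
  qed
qed

theorem proposition2p2:
  fixes M :: "'w measure" and F :: "real \<Rightarrow> 'w measure"
    and \<Lambda> \<gamma> \<Delta>t :: real
    and \<theta> :: "nat \<Rightarrow> 'n::{finite,linorder} \<Rightarrow> 'n"
    and f0 :: "real^'d \<Rightarrow> real"
    and W :: "nat \<Rightarrow> 'n \<Rightarrow> real \<Rightarrow> 'w \<Rightarrow> real^'d"
    and V :: "'n \<Rightarrow> real \<Rightarrow> 'w \<Rightarrow> real^'d"
    and f :: "real \<Rightarrow> (real^'d)^'n::{finite,linorder} \<Rightarrow> real"
  assumes "CARD('d) \<ge> 2" and "even CARD('n)"
    and "\<Lambda> > 0" and "- real CARD('d) - 1 < \<gamma>" and "\<gamma> \<le> 1" and "\<Delta>t > 0"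
    and "collisional_particle_system M F \<Lambda> \<gamma> \<Delta>t \<theta> f0 W V"
    and "joint_law_density M V f"
    and "properly_regular \<Lambda> \<gamma> \<Delta>t \<theta> f"
  shows "antimono_on {0..} (\<lambda>t. normalized_entropy (f t))"
proof (rule antimono_on_of_windows[OF \<open>\<Delta>t > 0\<close>])
  fix m :: nat and s t :: real
  assume "real m * \<Delta>t \<le> s" "s \<le> t" "t \<le> real (Suc m) * \<Delta>t"
  moreover have "pairing (\<theta> m)"
    using \<open>collisional_particle_system M F \<Lambda> \<gamma> \<Delta>t \<theta> f0 W V\<close>
    by (rule collisional_particle_system.pairing)
  ultimately show "normalized_entropy (f t) \<le> normalized_entropy (f s)"
    using \<open>properly_regular \<Lambda> \<gamma> \<Delta>t \<theta> f\<close> \<open>\<Lambda> > 0\<close> \<open>\<Delta>t > 0\<close>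
    by (intro normalized_entropy_decreases_on_closed_window) auto
qed

end
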